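(* Let $\mathrm{k}$ be a field of characteristic zero, and let $\tilde M'=\tilde L'\tilde U'$ be the LU-decomposition of the infinite matrix $\tilde M'=(\tilde M'_{ij})_{i,j\ge1}$ with entries $$\tilde M'_{ij}=x^i\binom{i+j-2}{j-1}-(-1)^{j-1}\binom{i}{j-1}\in\mathrm{k}[x].$$ Then the entries of $\tilde L'$ and of its inverse $(\tilde L')^{-1}$ are given, for $i\ge j\ge 1$, by $$(\tilde L')_{ij}=(-1)^{i-j}\,p_{i-j}^{-i,-i}(x),\qquad \left((\tilde L')^{-1}\right)_{ij}=(-1)^{i-j}\,\frac{j}{i}\,p_{i-j}^{j,j}(x)$$ (all entries with $i<j$ being zero).
   Context: LU-decomposition means $\tilde L'$ is lower triangular with $1$'s on the diagonal and $\tilde U'$ is upper triangular, the matrices being infinite and indexed by $i,j\ge1$ with entries in $\mathrm{k}(x)$ (such a decomposition of $\tilde M'$ exists and is unique). For integers $n\ge0$ and rational $\alpha,\beta$, the Jacobi polynomial is $$P^{\alpha,\beta}_n(x)=\frac1{n!}\sum_{k=0}^n\binom{n}{k}(n+\alpha+\beta+1)\cdots(n+\alpha+\beta+k)\,(\alpha+k+1)\cdots(\alpha+n)\left(\frac{x-1}{2}\right)^k$$ (empty products equal $1$), and $p_n^{\alpha,\beta}(x)=(x-1)^nP_n^{\alpha,\beta}\left(\frac{x+1}{x-1}\right)$, which is a polynomial in $x$. *)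

theory Defs
  imports "HOL-Computational_Algebra.Computational_Algebra"
begin

text \<open>
  An infinite matrix indexed by $i, j \ge 1$ is a function \<open>nat \<Rightarrow> nat \<Rightarrow> 'b\<close> whose values at
  index \<open>0\<close> are irrelevant: every notion below only inspects indices \<open>\<ge> 1\<close>.
\<close>

definition row_finite :: "(nat \<Rightarrow> nat \<Rightarrow> 'b::zero) \<Rightarrow> bool" where
  "row_finite A \<longleftrightarrow> (\<forall>i\<ge>1. finite {k. k \<ge> 1 \<and> A i k \<noteq> 0})"

text \<open>
  The sum runs over the support of row \<open>i\<close> of the left factor, so this is the matrix product
  whenever \<open>A\<close> is row-finite (in particular lower triangular); it is only used in that case.
\<close>

definition inf_mat_mult ::
    "(nat \<Rightarrow> nat \<Rightarrow> 'b::semiring_0) \<Rightarrow> (nat \<Rightarrow> nat \<Rightarrow> 'b) \<Rightarrow> nat \<Rightarrow> nat \<Rightarrow> 'b" where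
  "inf_mat_mult A B i j = (\<Sum>k | k \<ge> 1 \<and> A i k \<noteq> 0. A i k * B k j)"

definition lower_unitriangular :: "(nat \<Rightarrow> nat \<Rightarrow> 'b::zero_neq_one) \<Rightarrow> bool" where
  "lower_unitriangular L \<longleftrightarrow>
     (\<forall>i\<ge>1. L i i = 1) \<and> (\<forall>i\<ge>1. \<forall>j\<ge>1. i < j \<longrightarrow> L i j = 0)"

definition upper_triangular_inf :: "(nat \<Rightarrow> nat \<Rightarrow> 'b::zero) \<Rightarrow> bool" where
  "upper_triangular_inf U \<longleftrightarrow> (\<forall>i\<ge>1. \<forall>j\<ge>1. j < i \<longrightarrow> U i j = 0)"

definition is_LU_decomposition ::
    "(nat \<Rightarrow> nat \<Rightarrow> 'b::ring_1) \<Rightarrow> (nat \<Rightarrow> nat \<Rightarrow> 'b) \<Rightarrow> (nat \<Rightarrow> nat \<Rightarrow> 'b) \<Rightarrow> bool" where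
  "is_LU_decomposition M L U \<longleftrightarrow>
     lower_unitriangular L \<and> upper_triangular_inf U \<and>
     (\<forall>i\<ge>1. \<forall>j\<ge>1. M i j = inf_mat_mult L U i j)"

definition is_inf_mat_inverse ::
    "(nat \<Rightarrow> nat \<Rightarrow> 'b::ring_1) \<Rightarrow> (nat \<Rightarrow> nat \<Rightarrow> 'b) \<Rightarrow> bool" where
  "is_inf_mat_inverse A B \<longleftrightarrow>
     row_finite A \<and> row_finite B \<and>
     (\<forall>i\<ge>1. \<forall>j\<ge>1. inf_mat_mult A B i j = (if i = j then 1 else 0) \<and>
                     inf_mat_mult B A i j = (if i = j then 1 else 0))"

definition jacobi_poly :: "rat \<Rightarrow> rat \<Rightarrow> nat \<Rightarrow> rat poly" where
  "jacobi_poly \<alpha> \<beta> n =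
     smult (1 / fact n)
       (\<Sum>k=0..n. smult (of_nat (n choose k)
                        * (\<Prod>m=1..k. of_nat n + \<alpha> + \<beta> + of_nat m)
                        * (\<Prod>m=k+1..n. \<alpha> + of_nat m))
                  ([:-1/2, 1/2:] ^ k))"

text \<open>The field $\mathrm{k}(x)$ is \<open>'a poly fract\<close>, and this is its generator \<open>x\<close>.\<close>

definition ratfun_X :: "'a::field poly fract" where
  "ratfun_X = to_fract [:0, 1:]"

text \<open>
  $p_n^{\alpha,\beta}(x) = (x-1)^n P_n^{\alpha,\beta}\left(\frac{x+1}{x-1}\right)$ as an element of
  $\mathrm{k}(x)$; the rational coefficients of the Jacobi polynomial are mapped into
  $\mathrm{k} \subseteq \mathrm{k}(x)$.
\<close>

definition jacobi_p :: "rat \<Rightarrow> rat \<Rightarrow> nat \<Rightarrow> 'a::field_char_0 poly fract" where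
  "jacobi_p \<alpha> \<beta> n =
     (ratfun_X - 1) ^ n *
     poly (map_poly (\<lambda>c. to_fract [:of_rat c:]) (jacobi_poly \<alpha> \<beta> n))
          ((ratfun_X + 1) / (ratfun_X - 1))"

definition Mtilde :: "nat \<Rightarrow> nat \<Rightarrow> 'a::field_char_0 poly" where
  "Mtilde i j = [:0, 1:] ^ i * of_nat ((i + j - 2) choose (j - 1))
                - (-1) ^ (j - 1) * of_nat (i choose (j - 1))"

end

theory Submission
  imports Defs
begin

text \<open>
  Put \<open>q(z) = (1 - z)(1 - x z)\<close>. Writing \<open>q = (1 - z)\<^sup>2 (1 - (x - 1) z / (1 - z))\<close> and expanding
  shows that \<open>(-1)\<^sup>n p\<^sub>n\<close> with parameters \<open>c - n, c - n\<close> is the coefficient of \<open>z\<^sup>n\<close> in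
  \<open>q\<^sup>c\<close>. Hence column \<open>j\<close> of the claimed \<open>L\<close> has generating function \<open>\<phi>\<^sup>j\<close> with
  \<open>\<phi> = z / q\<close>, and the claimed inverse is the one that Lagrange inversion predicts.
  With \<open>a = 1 / (1 - x z)\<close> and \<open>b = - z / (1 - z)\<close>, column \<open>j\<close> of the given matrix has
  generating function \<open>a\<^sup>j + b\<^sup>j - a\<^sup>j\<^sup>-\<^sup>1 - b\<^sup>j\<^sup>-\<^sup>1\<close> up to its constant term. Since
  \<open>a + b = 1 + (x - 1) \<phi>\<close> and \<open>a b = - \<phi>\<close>, this is a polynomial of degree \<open>j\<close> in \<open>\<phi>\<close> with
  leading coefficient \<open>(x - 1)\<^sup>j\<close>; its coefficients form column \<open>j\<close> of \<open>U\<close>, and as the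
  diagonal of \<open>U\<close> does not vanish, the decomposition is unique.
\<close>

subsection \<open>Infinite triangular matrices\<close>

lemma inf_mat_mult_eq_sum:
  assumes "finite T" "\<And>k. k \<in> T \<Longrightarrow> k \<ge> 1" "\<And>k. k \<ge> 1 \<Longrightarrow> A i k \<noteq> 0 \<Longrightarrow> k \<in> T"
  shows "inf_mat_mult A B i j = (\<Sum>k\<in>T. A i k * B k j)"
  unfolding inf_mat_mult_def by (rule sum.mono_neutral_left) (use assms in auto)

lemma inf_mat_mult_lower_unitriangular:
  assumes "lower_unitriangular A" "1 \<le> i" "i \<le> n"
  shows "inf_mat_mult A B i j = (\<Sum>k=1..n. A i k * B k j)"
  using assms by (intro inf_mat_mult_eq_sum) (force simp: lower_unitriangular_def)+

lemma inf_mat_mult_lower_unitriangular_split: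
  fixes A B :: "nat \<Rightarrow> nat \<Rightarrow> 'a::ring_1"
  assumes "lower_unitriangular A" "1 \<le> i"
  shows "inf_mat_mult A B i j = (\<Sum>k=1..<i. A i k * B k j) + B i j"
proof -
  have "{1..i} = insert i {1..<i}" using assms by auto
  moreover have "A i i = 1" using assms by (simp add: lower_unitriangular_def)
  ultimately show ?thesis
    using inf_mat_mult_lower_unitriangular[OF assms order.refl, of B j] by (simp add: add.commute)
qed

lemma row_finite_lower_unitriangular: "lower_unitriangular A \<Longrightarrow> row_finite A"
  unfolding row_finite_def lower_unitriangular_def
proof (intro allI impI)
  fix i :: nat
  assume "(\<forall>i\<ge>1. A i i = 1) \<and> (\<forall>i\<ge>1. \<forall>j\<ge>1. i < j \<longrightarrow> A i j = 0)" "1 \<le> i"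
  hence "{k. 1 \<le> k \<and> A i k \<noteq> 0} \<subseteq> {1..i}" by force
  thus "finite {k. 1 \<le> k \<and> A i k \<noteq> 0}" by (rule finite_subset) simp
qed

text \<open>Induction on j fixes row j of \<open>U\<close> first, then column j of \<open>L\<close>:
  once the earlier rows and columns agree, entry (j, m) of \<open>M\<close> gives
  \<open>U j m\<close>, and entry (i, j) gives \<open>L i j * U j j\<close>, where the pivot
  cancels.\<close>

lemma LU_decomposition_unique:
  fixes L U :: "nat \<Rightarrow> nat \<Rightarrow> 'a::idom"
  assumes dec: "is_LU_decomposition M L U" and dec': "is_LU_decomposition M L' U'"
    and nz: "\<And>j. j \<ge> 1 \<Longrightarrow> U j j \<noteq> 0"
    and "1 \<le> i" "1 \<le> j"
  shows "L i j = L' i j"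
proof -
  have col: "M i j = (\<Sum>k=1..<j. L i k * U k j) + L i j * U j j"
    if "is_LU_decomposition M L U" "1 \<le> i" "1 \<le> j" for L U :: "nat \<Rightarrow> nat \<Rightarrow> 'a" and i j
  proof -
    have L: "lower_unitriangular L" and U: "upper_triangular_inf U"
      and M: "M i j = inf_mat_mult L U i j"
      using that by (auto simp: is_LU_decomposition_def)
    \<comment> \<open>The bound \<open>max i j\<close> covers the support of row i of
      \<open>L\<close> and leaves upper triangularity of \<open>U\<close> to cut the range down to
      j.\<close>
    have "M i j = (\<Sum>k=1..max i j. L i k * U k j)"
      unfolding M by (rule inf_mat_mult_lower_unitriangular) (use L that in auto)
    also have "\<dots> = (\<Sum>k=1..j. L i k * U k j)"
      by (rule sum.mono_neutral_right) (use U that in \<open>auto simp: upper_triangular_inf_def\<close>)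
    also have "{1..j} = insert j {1..<j}" using that by auto
    finally show ?thesis by (simp add: add.commute)
  qed
  have row: "M i j = (\<Sum>k=1..<i. L i k * U k j) + U i j"
    if "is_LU_decomposition M L U" "1 \<le> i" "1 \<le> j" for L U :: "nat \<Rightarrow> nat \<Rightarrow> 'a" and i j
    using that inf_mat_mult_lower_unitriangular_split[of L i U j]
    by (simp add: is_LU_decomposition_def)
  have "(\<forall>i\<ge>1. L i j = L' i j) \<and> (\<forall>m\<ge>1. U j m = U' j m)" if "1 \<le> j" for j
    using that
  proof (induction j rule: less_induct)
    case (less j)
    have IH: "L i k * U k m = L' i k * U' k m" if "1 \<le> k" "k < j" "1 \<le> i" "1 \<le> m" for i k m
      using less.IH[of k] that by simp
    have U: "U j m = U' j m" if "1 \<le> m" for m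
    proof -
      have "(\<Sum>k=1..<j. L j k * U k m) = (\<Sum>k=1..<j. L' j k * U' k m)"
        by (intro sum.cong refl IH) (use less.prems that in auto)
      thus ?thesis
        using row[OF dec \<open>1 \<le> j\<close> that] row[OF dec' \<open>1 \<le> j\<close> that] by simp
    qed
    moreover have "L i j = L' i j" if "1 \<le> i" for i
    proof -
      have "(\<Sum>k=1..<j. L i k * U k j) = (\<Sum>k=1..<j. L' i k * U' k j)"
        by (intro sum.cong refl IH) (use less.prems that in auto)
      thus ?thesis
        using col[OF dec that \<open>1 \<le> j\<close>] col[OF dec' that \<open>1 \<le> j\<close>] nz[OF \<open>1 \<le> j\<close>] U[OF \<open>1 \<le> j\<close>]
        by simp
    qed
    ultimately show ?case by blast
  qed
  thus ?thesis using assms by blast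
qed

text \<open>This is N = N (L N') = (N L) N' = N', carried out on a finite block so that the sums may
  be swapped.\<close>

lemma inf_mat_inverse_unique:
  fixes L N :: "nat \<Rightarrow> nat \<Rightarrow> 'a::ring_1"
  assumes L: "lower_unitriangular L"
    and N: "is_inf_mat_inverse L N" and N': "is_inf_mat_inverse L' N'"
    and eq: "\<And>i j. 1 \<le> i \<Longrightarrow> 1 \<le> j \<Longrightarrow> L i j = L' i j"
    and ij: "1 \<le> i" "1 \<le> j"
  shows "N i j = N' i j"
proof -
  have "finite {k. k \<ge> 1 \<and> N i k \<noteq> 0}"
    using N ij by (simp add: is_inf_mat_inverse_def row_finite_def)
  then obtain b where b: "\<And>k. k \<ge> 1 \<Longrightarrow> N i k \<noteq> 0 \<Longrightarrow> k \<le> b"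
    unfolding finite_nat_set_iff_bounded_le by blast
  \<comment> \<open>\<open>N\<close> is only known to be row-finite, so the block must contain the
    support of its row i, as well as the indices i and j picked out by the two Kronecker
    deltas.\<close>
  define n where "n = Max {b, i, j}"
  have n: "i \<le> n" "j \<le> n" "b \<le> n" by (auto simp: n_def)
  have NL: "(\<Sum>k=1..n. N i k * L k m) = (if i = m then 1 else 0)" if "1 \<le> m" for m
  proof -
    have "(\<Sum>k=1..n. N i k * L k m) = inf_mat_mult N L i m"
      by (rule sym, rule inf_mat_mult_eq_sum) (use b n in force)+
    thus ?thesis using N ij that by (simp add: is_inf_mat_inverse_def)
  qed
  have LN': "(\<Sum>m=1..n. L k m * N' m j) = (if k = j then 1 else 0)" if "1 \<le> k" "k \<le> n" for k
  proof -
    have L': "lower_unitriangular L'"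
      using L eq by (simp add: lower_unitriangular_def)
    have "(\<Sum>m=1..n. L k m * N' m j) = (\<Sum>m=1..n. L' k m * N' m j)"
      by (intro sum.cong refl) (use eq that in auto)
    also have "\<dots> = inf_mat_mult L' N' k j"
      by (rule sym, rule inf_mat_mult_lower_unitriangular) (use L' that in auto)
    finally show ?thesis using N' ij that by (simp add: is_inf_mat_inverse_def)
  qed
  have "N i j = (\<Sum>k=1..n. N i k * (if k = j then 1 else 0))"
    using ij n by (simp add: if_distrib cong: if_cong)
  also have "\<dots> = (\<Sum>k=1..n. N i k * (\<Sum>m=1..n. L k m * N' m j))"
    by (intro sum.cong refl arg_cong2[where f = "(*)"] LN' [symmetric]) auto
  also have "\<dots> = (\<Sum>m=1..n. (\<Sum>k=1..n. N i k * L k m) * N' m j)"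
    by (simp add: sum_distrib_left sum_distrib_right mult.assoc) (rule sum.swap)
  also have "\<dots> = (\<Sum>m=1..n. (if i = m then 1 else 0) * N' m j)"
    by (intro sum.cong refl arg_cong2[where f = "(*)"] NL) auto
  also have "\<dots> = N' i j"
    using ij n by (simp add: mult_delta_left)
  finally show ?thesis .
qed

text \<open>A left inverse suffices: in row i of N (L N) = N the term k = i has coefficient 1, and
  induction supplies the rows of \<open>L N\<close> above it.\<close>

lemma is_inf_mat_inverse_lower_unitriangularI:
  fixes L N :: "nat \<Rightarrow> nat \<Rightarrow> 'a::ring_1"
  assumes L: "lower_unitriangular L" and N: "lower_unitriangular N"
    and NL: "\<And>i j. 1 \<le> i \<Longrightarrow> 1 \<le> j \<Longrightarrow> inf_mat_mult N L i j = (if i = j then 1 else 0)"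
  shows "is_inf_mat_inverse L N"
proof -
  have "inf_mat_mult L N i j = (if i = j then 1 else 0)" if "1 \<le> i" "1 \<le> j" for i j
    using that(1)
  proof (induction i rule: less_induct)
    case (less i)
    have NL': "(\<Sum>k=1..i. N i k * L k m) = (if i = m then 1 else 0)" if "1 \<le> m" for m
      using NL[OF less.prems that] inf_mat_mult_lower_unitriangular[OF N less.prems order.refl, of L m]
      by simp
    have NLN: "(\<Sum>k=1..i. N i k * inf_mat_mult L N k j) = N i j"
    proof -
      have "(\<Sum>k=1..i. N i k * inf_mat_mult L N k j) =
              (\<Sum>k=1..i. N i k * (\<Sum>m=1..i. L k m * N m j))"
        by (intro sum.cong refl arg_cong2[where f = "(*)"] inf_mat_mult_lower_unitriangular L) auto
      also have "\<dots> = (\<Sum>m=1..i. (\<Sum>k=1..i. N i k * L k m) * N m j)"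
        by (simp add: sum_distrib_left sum_distrib_right mult.assoc) (rule sum.swap)
      also have "\<dots> = (\<Sum>m=1..i. (if i = m then 1 else 0) * N m j)"
        using less.prems
        by (intro sum.cong refl arg_cong2[where f = "(*)"] NL') auto
      also have "\<dots> = N i j"
        using less.prems by (simp add: if_distribR mult_delta_left)
      finally show ?thesis .
    qed
    have "{1..i} = insert i {1..<i}" "N i i = 1"
      using less.prems N by (auto simp: lower_unitriangular_def)
    hence "inf_mat_mult L N i j = N i j - (\<Sum>k=1..<i. N i k * inf_mat_mult L N k j)"
      using NLN by (simp add: algebra_simps)
    also have "(\<Sum>k=1..<i. N i k * inf_mat_mult L N k j) = (\<Sum>k=1..<i. if k = j then N i k else 0)"
      by (intro sum.cong refl) (use less.IH in auto)
    also have "\<dots> = (if j < i then N i j else 0)"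
      using that by simp
    finally show ?case
      using N less.prems that by (auto simp: lower_unitriangular_def)
  qed
  thus ?thesis
    using NL L N by (simp add: is_inf_mat_inverse_def row_finite_lower_unitriangular)
qed

subsection \<open>Jacobi polynomials over the field of rational functions\<close>

text \<open>Makes \<open>of_rat\<close>, \<open>gchoose\<close> and \<open>fps_binomial\<close>
  usable over the field of rational functions.\<close>

instance fract :: ("{idom,ring_char_0}") field_char_0
proof
  show "inj (of_nat :: nat \<Rightarrow> 'a fract)"
    by (auto simp: inj_def of_nat_fract eq_fract)
qed

lemma to_fract_of_nat: "to_fract (of_nat n) = of_nat n"
  by (simp add: to_fract_def of_nat_fract)

lemma to_fract_of_int: "to_fract (of_int n) = of_int n"
  by (cases n rule: int_cases2) (simp_all add: to_fract_of_nat)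

lemma to_fract_power: "to_fract (p ^ n) = to_fract p ^ n"
  by (induction n) simp_all

text \<open>Identifies the coefficient embedding in \<open>jacobi_p\<close> with
  \<open>of_rat\<close>; multiplying by the denominator reduces it to integers.\<close>

lemma to_fract_const_of_rat: "to_fract [:of_rat c::'a::field_char_0:] = of_rat c"
proof (cases c)
  case (Fract a b)
  hence c: "c = of_int a / of_int b" by (simp add: Fract_of_int_quotient)
  have "to_fract [:of_rat c::'a:] * of_int b = to_fract ([:of_rat c:] * of_int b)"
    by (simp only: to_fract_mult to_fract_of_int)
  also have "[:of_rat c::'a:] * of_int b = of_int a"
    using \<open>b > 0\<close> by (simp add: c of_int_poly of_rat_divide)
  finally show ?thesis
    using \<open>b > 0\<close> by (simp add: c of_rat_divide field_simps to_fract_of_int)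
qed

lemma of_rat_gbinomial: "of_rat (a gchoose k) = ((of_rat a :: 'a::field_char_0) gchoose k)"
proof -
  have "of_rat (fact k) = (fact k :: 'a)"
    by (metis of_nat_fact of_rat_of_nat_eq)
  thus ?thesis
    by (simp add: gbinomial_prod_rev of_rat_divide of_rat_prod of_rat_diff)
qed

text \<open>With the next four lemmas: evaluating a rational polynomial at t is a ring
  homomorphism.\<close>

lemma poly_map_poly_of_rat_add:
  "poly (map_poly of_rat (p + q)) (t::'a::field_char_0) =
     poly (map_poly of_rat p) t + poly (map_poly of_rat q) t"
  by (induction p q rule: poly_induct2) (simp_all add: map_poly_pCons of_rat_add algebra_simps)

lemma poly_map_poly_of_rat_smult:
  "poly (map_poly of_rat (smult c p)) (t::'a::field_char_0) = of_rat c * poly (map_poly of_rat p) t"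
  by (induction p) (simp_all add: map_poly_pCons of_rat_mult algebra_simps)

lemma poly_map_poly_of_rat_mult:
  "poly (map_poly of_rat (p * q)) (t::'a::field_char_0) =
     poly (map_poly of_rat p) t * poly (map_poly of_rat q) t"
  by (induction p)
     (simp_all add: map_poly_pCons poly_map_poly_of_rat_add poly_map_poly_of_rat_smult algebra_simps)

lemma poly_map_poly_of_rat_power:
  "poly (map_poly of_rat (p ^ n)) (t::'a::field_char_0) = poly (map_poly of_rat p) t ^ n"
  by (induction n) (simp_all add: poly_map_poly_of_rat_mult)

lemma poly_map_poly_of_rat_sum:
  "poly (map_poly of_rat (sum f A)) (t::'a::field_char_0) = (\<Sum>i\<in>A. poly (map_poly of_rat (f i)) t)"
  by (induction A rule: infinite_finite_induct) (simp_all add: poly_map_poly_of_rat_add)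

text \<open>Both products are rising factorials, and (n choose k) / n! = 1 / (k! (n - k)!) supplies
  the denominators of the two binomials.\<close>

lemma jacobi_coeff:
  fixes \<alpha> \<beta> :: "'a::field_char_0"
  assumes "k \<le> n"
  shows "1 / fact n * (of_nat (n choose k) * (\<Prod>m=1..k. of_nat n + \<alpha> + \<beta> + of_nat m)
           * (\<Prod>m=k+1..n. \<alpha> + of_nat m)) =
         ((\<alpha> + of_nat n) gchoose (n - k)) * ((\<alpha> + \<beta> + of_nat n + of_nat k) gchoose k)"
proof -
  have "(\<Prod>m=1..k. of_nat n + \<alpha> + \<beta> + of_nat m) = pochhammer (\<alpha> + \<beta> + of_nat n + 1) k"
    unfolding pochhammer_prod
    by (rule prod.reindex_bij_witness[where i = Suc and j = "\<lambda>m. m - 1"]) (auto simp: of_nat_diff)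
  moreover have "(\<Prod>m=k+1..n. \<alpha> + of_nat m) = pochhammer (\<alpha> + of_nat k + 1) (n - k)"
    unfolding pochhammer_prod
    by (rule prod.reindex_bij_witness[where i = "\<lambda>m. m + k + 1" and j = "\<lambda>m. m - k - 1"])
       (use assms in \<open>auto simp: of_nat_diff\<close>)
  ultimately show ?thesis
    using assms by (simp add: gbinomial_pochhammer' binomial_fact of_nat_diff field_simps)
qed

lemma ratfun_X_neq_1: "ratfun_X - 1 \<noteq> (0 :: 'a::field poly fract)"
proof -
  have "(ratfun_X - 1 :: 'a poly fract) = to_fract ([:0, 1:] - 1)"
    by (simp add: ratfun_X_def)
  also have "\<dots> \<noteq> 0"
    by (simp only: to_fract_eq_0_iff) (simp add: one_pCons)
  finally show ?thesis .
qed

lemma jacobi_p_altdef: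
  "(jacobi_p \<alpha> \<beta> n :: 'a::field_char_0 poly fract) =
     (\<Sum>k=0..n. ((of_rat \<alpha> + of_nat n) gchoose (n - k)) *
        ((of_rat \<alpha> + of_rat \<beta> + of_nat n + of_nat k) gchoose k) * (ratfun_X - 1) ^ (n - k))"
proof -
  define Y :: "'a poly fract" where "Y = ratfun_X - 1"
  have Y: "Y \<noteq> 0" unfolding Y_def by (rule ratfun_X_neq_1)
  \<comment> \<open>At (x + 1) / (x - 1) the base (t - 1) / 2 becomes 1 / (x - 1), so the prefactor
    \<open>Y ^ n\<close> clears all denominators.\<close>
  have half: "poly (map_poly of_rat [:-1/2, 1/2:]) ((ratfun_X + 1) / Y) = 1 / Y"
    using Y by (simp add: map_poly_pCons of_rat_divide of_rat_minus Y_def field_simps)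
  have "jacobi_p \<alpha> \<beta> n =
    Y ^ n * (of_rat (1 / fact n) * (\<Sum>k=0..n. of_rat (of_nat (n choose k)
                        * (\<Prod>m=1..k. of_nat n + \<alpha> + \<beta> + of_nat m)
                        * (\<Prod>m=k+1..n. \<alpha> + of_nat m)) * (1 / Y) ^ k))"
    unfolding jacobi_p_def jacobi_poly_def Y_def [symmetric] to_fract_const_of_rat
      poly_map_poly_of_rat_smult poly_map_poly_of_rat_sum poly_map_poly_of_rat_power half ..
  also have "\<dots> = (\<Sum>k=0..n. of_rat (1 / fact n * (of_nat (n choose k)
                        * (\<Prod>m=1..k. of_nat n + \<alpha> + \<beta> + of_nat m)
                        * (\<Prod>m=k+1..n. \<alpha> + of_nat m))) * (Y ^ n * (1 / Y) ^ k))"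
    by (simp only: sum_distrib_left of_rat_mult mult_ac)
  also have "\<dots> = (\<Sum>k=0..n. ((of_rat \<alpha> + of_nat n) gchoose (n - k)) *
        ((of_rat \<alpha> + of_rat \<beta> + of_nat n + of_nat k) gchoose k) * Y ^ (n - k))"
  proof (intro sum.cong refl arg_cong2[where f = "(*)"])
    fix k assume "k \<in> {0..n}"
    hence k: "k \<le> n" by simp
    show "of_rat (1 / fact n * (of_nat (n choose k)
                        * (\<Prod>m=1..k. of_nat n + \<alpha> + \<beta> + of_nat m)
                        * (\<Prod>m=k+1..n. \<alpha> + of_nat m))) =
      ((of_rat \<alpha> + of_nat n) gchoose (n - k)) *
        ((of_rat \<alpha> + of_rat \<beta> + of_nat n + of_nat k :: 'a poly fract) gchoose k)"
      unfolding jacobi_coeff[OF k]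
      by (simp add: of_rat_mult of_rat_gbinomial of_rat_add)
    show "Y ^ n * (1 / Y) ^ k = Y ^ (n - k)"
      using Y k by (simp add: power_diff field_simps)
  qed
  finally show ?thesis unfolding Y_def .
qed

subsection \<open>Powers of $(1-z)(1-xz)$\<close>

definition qfps :: "'a::comm_ring_1 \<Rightarrow> 'a fps" where
  "qfps x = (1 - fps_X) * (1 - fps_const x * fps_X)"

lemma qfps_nth_0 [simp]: "qfps x $ 0 = 1"
  by (simp add: qfps_def)

lemma fps_mult_compose_X_mult_nth:
  fixes f a u :: "'a::comm_ring_1 fps"
  shows "(f * (a oo (fps_X * u))) $ n = (\<Sum>k=0..n. a $ k * (f * u ^ k) $ (n - k))"
proof -
  \<comment> \<open>Powers \<open>(fps_X * u) ^ k\<close> with k > m do not reach degree m, so one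
    range 0..n serves all m and the sums can be swapped.\<close>
  have "(a oo (fps_X * u)) $ m = (\<Sum>k=0..n. a $ k * ((fps_X * u) ^ k) $ m)" if "m \<le> n" for m
    unfolding fps_compose_nth using that
    by (intro sum.mono_neutral_left) (auto simp: power_mult_distrib fps_X_power_mult_nth)
  hence "(f * (a oo (fps_X * u))) $ n =
           (\<Sum>i=0..n. \<Sum>k=0..n. a $ k * (f $ i * ((fps_X * u) ^ k) $ (n - i)))"
    by (simp add: fps_mult_nth sum_distrib_left mult_ac)
  also have "\<dots> = (\<Sum>k=0..n. a $ k * (f * (fps_X * u) ^ k) $ n)"
    by (subst sum.swap) (simp add: fps_mult_nth sum_distrib_left)
  also have "\<dots> = (\<Sum>k=0..n. a $ k * (f * u ^ k) $ (n - k))"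
    by (intro sum.cong refl) (simp add: power_mult_distrib fps_X_power_mult_nth mult.left_commute[of f])
  finally show ?thesis .
qed

text \<open>The power \<open>(qfps x)\<^sup>c\<close> for an arbitrary exponent \<open>c\<close>; it treats the positive powers in
  the inverse and the negative powers in \<open>L\<close> at once.\<close>
definition qpow :: "'a::field_char_0 \<Rightarrow> 'a \<Rightarrow> 'a fps" where
  "qpow x c = (fps_binomial (2 * c) oo (- fps_X)) *
     (fps_binomial c oo (fps_X * (- fps_const (x - 1) * inverse (1 - fps_X))))"

lemma inverse_one_minus_fps_X_power:
  "inverse (1 - fps_X :: 'a::field_char_0 fps) ^ k = fps_binomial (- of_nat k) oo (- fps_X)"
  using one_minus_fps_X_const_neg_power[of 1 k] by (simp flip: fps_inverse_power)

text \<open>In the expansion of the second factor, term k carries (1 - z)^(-k) and leaves (1 -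
  z)^(2c - k); reversing k to n - k yields the shape of the Jacobi sum.\<close>

lemma qpow_nth:
  "qpow x c $ n = (-1) ^ n * (\<Sum>k=0..n. (c gchoose (n - k)) *
     ((2 * c - of_nat n + of_nat k) gchoose k) * (x - 1) ^ (n - k))"
proof -
  have "qpow x c $ n = (\<Sum>k=0..n. (c gchoose k) *
      (-1) ^ n * (x - 1) ^ k * ((2 * c - of_nat k) gchoose (n - k)))"
    unfolding qpow_def fps_mult_compose_X_mult_nth
  proof (intro sum.cong refl)
    fix k assume k: "k \<in> {0..n}"
    have "(fps_binomial (2 * c) oo - fps_X) * (- fps_const (x - 1) * inverse (1 - fps_X)) ^ k
      = fps_const ((1 - x) ^ k) * (fps_binomial (2 * c - of_nat k) oo - fps_X)"
      using fps_binomial_add_mult[of "2 * c" "- of_nat k"]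
      by (simp add: power_mult_distrib inverse_one_minus_fps_X_power fps_compose_mult_distrib fps_const_power)
    thus "fps_binomial c $ k * ((fps_binomial (2 * c) oo - fps_X) * (- fps_const (x - 1) * inverse (1 - fps_X)) ^ k) $ (n - k)
      = (c gchoose k) * (-1) ^ n * (x - 1) ^ k * ((2 * c - of_nat k) gchoose (n - k))"
      using k power_mult_distrib[of "-1" "x - 1" k] by (simp add: fps_compose_uminus' flip: power_add)
  qed
  also have "\<dots> = (\<Sum>k=0..n. (c gchoose (n - k)) *
      (-1) ^ n * (x - 1) ^ (n - k) * ((2 * c - of_nat n + of_nat k) gchoose k))"
    by (rule sum.reindex_bij_witness[of _ "\<lambda>k. n - k" "\<lambda>k. n - k"]) (auto simp: of_nat_diff algebra_simps)
  finally show ?thesis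
    by (simp add: sum_distrib_left mult_ac)
qed

lemma fps_binomial_of_nat_compose:
  fixes g :: "'a::field_char_0 fps"
  assumes "g $ 0 = 0"
  shows "fps_binomial (of_nat n) oo g = (1 + g) ^ n"
  using assms by (simp add: fps_binomial_of_nat fps_compose_add_distrib flip: fps_compose_power)

lemma fps_binomial_minus_of_nat_compose:
  fixes g :: "'a::field_char_0 fps"
  assumes "g $ 0 = 0"
  shows "fps_binomial (- of_nat n) oo g = inverse (1 + g) ^ n"
  using assms by (simp add: fps_binomial_minus_of_nat fps_compose_add_distrib fps_inverse_compose
     fps_inverse_power flip: fps_compose_power)

lemma qfps_altdef:
  "qfps x = (1 - fps_X) ^ 2 * (1 + fps_X * (- fps_const (x - 1) * inverse (1 - fps_X :: 'a::field fps)))"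
proof -
  have "inverse (1 - fps_X) * (1 - fps_X :: 'a fps) = 1"
    by (rule inverse_mult_eq_1) simp
  hence "(1 - fps_X) ^ 2 * (1 + fps_X * (- fps_const (x - 1) * inverse (1 - fps_X))) =
     (1 - fps_X) ^ 2 - (1 - fps_X) * fps_X * fps_const (x - 1)"
    by algebra
  also have "\<dots> = qfps x"
    unfolding qfps_def fps_const_sub [symmetric] by (simp add: power2_eq_square algebra_simps)
  finally show ?thesis by simp
qed

lemma qpow_of_nat: "qpow x (of_nat m) = qfps x ^ m"
  using fps_binomial_of_nat_compose[of "- fps_X :: 'a fps" "2 * m"]
  by (simp add: qpow_def fps_binomial_of_nat_compose qfps_altdef power_mult_distrib power_mult)

lemma qpow_minus_of_nat: "qpow x (- of_nat m) = inverse (qfps x) ^ m"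
  using fps_binomial_minus_of_nat_compose[of "- fps_X :: 'a fps" "2 * m"]
  by (simp add: qpow_def fps_binomial_minus_of_nat_compose qfps_altdef power_mult_distrib power_mult
     fps_inverse_mult fps_inverse_power)

subsection \<open>The factors and the inverse\<close>

text \<open>The coefficient of z^i in \<phi>^j. The case i < j is explicit because
  \<open>i - j\<close> would truncate to 0 and give 1.\<close>

definition lmat :: "'a::field_char_0 \<Rightarrow> nat \<Rightarrow> nat \<Rightarrow> 'a" where
  "lmat x i j = (if i < j then 0 else (inverse (qfps x) ^ j) $ (i - j))"

text \<open>By Lagrange inversion, the coefficient of z^i in the j-th power of the compositional
  inverse of \<phi>.\<close>

definition nmat :: "'a::field_char_0 \<Rightarrow> nat \<Rightarrow> nat \<Rightarrow> 'a" where
  "nmat x i j = (if i < j then 0 else of_nat j / of_nat i * (qfps x ^ i) $ (i - j))"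

lemma lmat_lower_unitriangular: "lower_unitriangular (lmat x)"
  by (simp add: lower_unitriangular_def lmat_def fps_power_zeroth)

lemma nmat_lower_unitriangular: "lower_unitriangular (nmat x)"
  by (simp add: lower_unitriangular_def nmat_def fps_power_zeroth)

text \<open>The operator z d/dz multiplies the coefficient of z^n by n, and applied to q^n it also
  produces the factor n.\<close>

lemma fps_nth_mult_deriv_diagonal:
  fixes q :: "'a::field_char_0 fps"
  assumes "n > 0"
  shows "(q ^ n) $ n = (fps_X * fps_deriv q * q ^ (n - 1)) $ n"
proof -
  have "of_nat n * (q ^ n) $ n = (fps_X * fps_deriv (q ^ n)) $ n"
    using assms by simp
  also have "fps_X * fps_deriv (q ^ n) = fps_const (of_nat n) * (fps_X * fps_deriv q * q ^ (n - 1))"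
    by (simp add: fps_deriv_power mult_ac)
  also have "\<dots> $ n = of_nat n * (fps_X * fps_deriv q * q ^ (n - 1)) $ n"
    by (rule fps_mult_left_const_nth)
  finally show ?thesis using assms by simp
qed

text \<open>Since \<open>k [z\<^sup>k\<^sup>-\<^sup>j] h = [z\<^sup>k\<^sup>-\<^sup>j] (z h' + j h)\<close>, the factor \<open>k / i\<close> turns the sum into
  the coefficient of \<open>z\<^sup>n\<close>, \<open>n = i - j\<close>, in \<open>(j / i) (q\<^sup>n - z q' q\<^sup>n\<^sup>-\<^sup>1)\<close>, which vanishes for \<open>n > 0\<close>.\<close>
lemma nmat_lmat:
  assumes "1 \<le> i" "1 \<le> j"
  shows "inf_mat_mult (nmat x) (lmat x) i j = (if i = j then 1 else 0)"
proof (cases "j \<le> i")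
  case False
  have "inf_mat_mult (nmat x) (lmat x) i j = (\<Sum>k=1..i. nmat x i k * lmat x k j)"
    by (rule inf_mat_mult_lower_unitriangular) (use nmat_lower_unitriangular assms in auto)
  also have "\<dots> = 0" using False by (intro sum.neutral) (auto simp: lmat_def)
  finally show ?thesis using False by simp
next
  case True
  define n where "n = i - j"
  define q where "q = qfps x"
  define r where "r = inverse q"
  have qr: "q * r = 1" unfolding r_def q_def by (simp add: inverse_mult_eq_1')
  define h where "h = r ^ j"
  have "of_nat i * inf_mat_mult (nmat x) (lmat x) i j = of_nat i * (\<Sum>k=j..i. nmat x i k * lmat x k j)"
    unfolding inf_mat_mult_lower_unitriangular[OF nmat_lower_unitriangular assms(1) order.refl]
    using assms by (intro arg_cong2[where f = "(*)"] refl sum.mono_neutral_right) (auto simp: lmat_def)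
  also have "\<dots> = (\<Sum>k=j..i. (q ^ i) $ (i - k) * (of_nat k * h $ (k - j)))"
    using assms by (auto simp: sum_distrib_left nmat_def lmat_def q_def h_def r_def intro!: sum.cong)
  also have "\<dots> = (\<Sum>m=0..n. (q ^ i) $ (n - m) * (of_nat (m + j) * h $ m))"
    using True unfolding n_def
    by (intro sum.reindex_bij_witness[of _ "\<lambda>m. m + j" "\<lambda>k. k - j"]) auto
  also have "\<dots> = (\<Sum>m=0..n. (fps_X * fps_deriv h + of_nat j * h) $ m * (q ^ i) $ (n - m))"
  proof (intro sum.cong refl)
    fix m
    have "(fps_X * fps_deriv h) $ m = of_nat m * h $ m" by (cases m) simp_all
    thus "(q ^ i) $ (n - m) * (of_nat (m + j) * h $ m) =
            (fps_X * fps_deriv h + of_nat j * h) $ m * (q ^ i) $ (n - m)"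
      by (simp add: algebra_simps flip: fps_of_nat)
  qed
  also have "\<dots> = ((fps_X * fps_deriv h + of_nat j * h) * q ^ i) $ n"
    by (simp add: fps_mult_nth)
  \<comment> \<open>Uses h' = - j q' r^(j+1). The case n = 0 is separate since q^(n-1) is then r =
    1/q, whereas \<open>n - 1\<close> truncates.\<close>
  also have "(fps_X * fps_deriv h + of_nat j * h) * q ^ i =
     of_nat j * (q ^ n - (if n = 0 then fps_X * fps_deriv q * r else fps_X * fps_deriv q * q ^ (n - 1)))"
  proof -
    have "fps_deriv r = - fps_deriv q * r ^ 2"
      unfolding r_def by (rule fps_inverse_deriv) (simp add: q_def)
    moreover have "fps_deriv h = of_nat j * fps_deriv r * r ^ (j - 1)"
      by (simp add: h_def fps_deriv_power fps_of_nat)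
    moreover define R where "R = r ^ Suc j"
    moreover have "r ^ Suc j = r ^ 2 * r ^ (j - 1)"
      using assms by (cases j) (simp_all add: power2_eq_square mult.assoc)
    ultimately have dh: "fps_deriv h = - of_nat j * fps_deriv q * R"
      by (simp add: mult_ac)
    have rq: "h * q ^ i = q ^ n"
    proof -
      have "h * q ^ i = (q * r) ^ j * q ^ n"
        using True by (simp add: h_def n_def power_mult_distrib flip: power_add)
      thus ?thesis by (simp add: qr)
    qed
    have Rq: "R * q ^ i = (if n = 0 then r else q ^ (n - 1))"
    proof -
      have "R * q ^ i = r * q ^ n" using rq by (simp add: R_def h_def mult.assoc)
      thus ?thesis using qr by (cases n) (simp_all add: mult.left_commute[of r q])
    qed
    have "(fps_X * fps_deriv h + of_nat j * h) * q ^ i =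
            of_nat j * (h * q ^ i - fps_X * fps_deriv q * (R * q ^ i))"
      unfolding dh by (simp add: algebra_simps)
    thus ?thesis unfolding rq Rq by simp
  qed
  also have "\<dots> $ n = (if i = j then of_nat j else 0)"
    using fps_nth_mult_deriv_diagonal[of n q] True
    by (auto simp: n_def simp flip: fps_of_nat)
  finally show ?thesis using assms by (auto split: if_splits)
qed

text \<open>The recurrence of the power sums \<open>a\<^sup>n + b\<^sup>n\<close> as polynomials in \<open>\<phi> = - a b\<close>,
  where \<open>a + b = 1 + (x - 1) \<phi>\<close>.\<close>
fun spoly :: "'a::comm_ring_1 \<Rightarrow> nat \<Rightarrow> 'a poly" where
  "spoly x 0 = [:2:]"
| "spoly x (Suc 0) = [:1, x - 1:]"
| "spoly x (Suc (Suc n)) = [:1, x - 1:] * spoly x (Suc n) + [:0, 1:] * spoly x n"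

lemma coeff_spoly_above: "n < k \<Longrightarrow> coeff (spoly x n) k = 0"
proof (induction x n arbitrary: k rule: spoly.induct)
  case (3 x n)
  thus ?case by (cases k) (auto simp: coeff_pCons)
qed (auto simp: coeff_pCons split: nat.splits)

text \<open>The summand \<open>[:0, 1:] * spoly x n\<close> has degree at most n + 1, too small to
  affect the leading coefficient; index 0 is excluded because \<open>spoly x 0\<close> is 2.\<close>

lemma coeff_spoly_diag: "n \<ge> 1 \<Longrightarrow> coeff (spoly x n) n = (x - 1) ^ n"
proof (induction x n rule: spoly.induct)
  case (3 x n)
  thus ?case by (simp add: coeff_spoly_above)
qed auto

text \<open>Substituting \<phi> turns the recurrence into s(n+2) = (a + b) s(n+1) - a b s(n), which
  power sums satisfy.\<close>

lemma fps_of_poly_spoly_compose: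
  fixes x :: "'a::field_char_0"
  defines "a \<equiv> inverse (1 - fps_const x * fps_X)" and "b \<equiv> - (fps_X * inverse (1 - fps_X))"
  shows "fps_of_poly (spoly x n) oo (fps_X * inverse (qfps x)) = a ^ n + b ^ n"
proof -
  define \<phi> where "\<phi> = fps_X * inverse (qfps x)"
  have a: "a * (1 - fps_const x * fps_X) = 1" unfolding a_def by (rule inverse_mult_eq_1) simp
  have b: "b * (1 - fps_X) = - fps_X" unfolding b_def
    by (simp add: mult.assoc inverse_mult_eq_1)
  have phi: "\<phi> = - a * b"
    unfolding \<phi>_def a_def b_def qfps_def by (simp add: fps_inverse_mult)
  \<comment> \<open>The formula for a + b is checked after clearing denominators; the nonzero factor
    then cancels.\<close>
  have "(1 - fps_X) * (1 - fps_const x * fps_X) * (a + b) =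
        (1 - fps_X) * (1 - fps_const x * fps_X) * (1 + fps_const (x - 1) * \<phi>)"
    unfolding phi fps_const_sub [symmetric] fps_const_1_eq_1 using a b by algebra
  moreover have "(1 - fps_X) * (1 - fps_const x * fps_X) \<noteq> 0"
    by (metis qfps_def qfps_nth_0 fps_zero_nth zero_neq_one)
  ultimately have ab: "a + b = 1 + fps_const (x - 1) * \<phi>" by simp
  have [simp]: "\<phi> $ 0 = 0" by (simp add: \<phi>_def)
  have lin: "fps_of_poly [:1, x - 1:] oo \<phi> = a + b"
    unfolding ab by (simp add: fps_of_poly_pCons fps_compose_add_distrib fps_compose_mult_distrib)
  have X: "fps_of_poly [:0, 1:] oo \<phi> = - a * b"
    unfolding phi [symmetric] by (simp add: fps_of_poly_pCons)
  show ?thesis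
    unfolding \<phi>_def [symmetric]
  proof (induction n rule: induct_nat_012)
    case 0
    show ?case by (simp add: numeral_fps_const)
  next
    case 1
    show ?case using lin by simp
  next
    case (ge2 n)
    show ?case
      unfolding spoly.simps fps_of_poly_add fps_of_poly_mult fps_compose_add_distrib
       fps_compose_mult_distrib[OF \<open>\<phi> $ 0 = 0\<close>] lin X ge2
      by (simp add: algebra_simps)
  qed
qed

definition umat :: "'a::field_char_0 \<Rightarrow> nat \<Rightarrow> nat \<Rightarrow> 'a" where
  "umat x k j = coeff (spoly x j - spoly x (j - 1)) k"

lemma umat_upper_triangular: "upper_triangular_inf (umat x)"
  by (auto simp: upper_triangular_inf_def umat_def coeff_spoly_above)

lemma umat_diag: "j \<ge> 1 \<Longrightarrow> umat x j j = (x - 1) ^ j"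
  by (simp add: umat_def coeff_spoly_above coeff_spoly_diag)

lemma lmat_umat:
  fixes x :: "'a::field_char_0"
  assumes "1 \<le> i" "1 \<le> j"
  shows "inf_mat_mult (lmat x) (umat x) i j =
    x ^ i * of_nat ((i + j - 2) choose (j - 1)) - (-1) ^ (j - 1) * of_nat (i choose (j - 1))"
proof -
  define \<phi> where "\<phi> = fps_X * inverse (qfps x)"
  define a where "a = inverse (1 - fps_const x * fps_X)"
  define b where "b = - (fps_X * inverse (1 - fps_X :: 'a fps))"
  have "inf_mat_mult (lmat x) (umat x) i j = (\<Sum>k=1..i. umat x k j * (\<phi> ^ k) $ i)"
    unfolding inf_mat_mult_lower_unitriangular[OF lmat_lower_unitriangular assms(1) order.refl]
    by (intro sum.cong refl) (auto simp: lmat_def \<phi>_def power_mult_distrib fps_X_power_mult_nth)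
  \<comment> \<open>The new term k = 0 vanishes because \<phi>^0 = 1 has no coefficient at i \<ge>
    1; constant terms thus do not matter.\<close>
  also have "\<dots> = (\<Sum>k=0..i. umat x k j * (\<phi> ^ k) $ i)"
    using assms by (intro sum.mono_neutral_left) (auto simp: not_le)
  also have "\<dots> = (fps_of_poly (spoly x j - spoly x (j - 1)) oo \<phi>) $ i"
    by (simp add: fps_compose_nth umat_def)
  also have "\<dots> = (a ^ j - a ^ (j - 1)) $ i + (b ^ j - b ^ (j - 1)) $ i"
    by (simp add: fps_of_poly_diff fps_compose_sub_distrib fps_of_poly_spoly_compose a_def b_def \<phi>_def)
  \<comment> \<open>Comes from a - 1 = x z a.\<close>
  also have "a ^ j - a ^ (j - 1) = fps_const x * (fps_X * a ^ j)"
  proof -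
    have "a * (1 - fps_const x * fps_X) = 1" unfolding a_def by (rule inverse_mult_eq_1) simp
    hence "a - 1 = fps_const x * fps_X * a" by (simp add: algebra_simps)
    moreover have aj: "a ^ j = a ^ (j - 1) * a" using assms by (cases j) simp_all
    hence "a ^ j - a ^ (j - 1) = a ^ (j - 1) * (a - 1)" by (simp add: algebra_simps)
    ultimately show ?thesis by (simp add: aj mult_ac)
  qed
  also have "(fps_const x * (fps_X * a ^ j)) $ i = x ^ i * of_nat ((i + j - 2) choose (j - 1))"
  proof -
    have "a ^ j = Abs_fps (\<lambda>k. of_nat ((j + k - 1) choose k) * x ^ k)"
      using assms unfolding a_def fps_inverse_power [symmetric]
      by (intro one_minus_const_fps_X_neg_power') simp
    moreover have "(i + j - 2) choose (i - 1) = (i + j - 2) choose (j - 1)"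
      using assms binomial_symmetric[of "i - 1" "i + j - 2"] by simp
    moreover have "j + (i - 1) - 1 = i + j - 2" "x ^ i = x * x ^ (i - 1)"
      using assms by (simp_all add: power_eq_if)
    ultimately show ?thesis using assms by (simp add: fps_X_mult_nth)
  qed
  \<comment> \<open>Comes from b - 1 = - 1 / (1 - z).\<close>
  also have "b ^ j - b ^ (j - 1) =
    - fps_const ((-1) ^ (j - 1)) * (fps_X ^ (j - 1) * inverse ((1 - fps_X) ^ j))"
  proof -
    define c where "c = inverse (1 - fps_X :: 'a fps)"
    have "c * (1 - fps_X) = 1" unfolding c_def by (rule inverse_mult_eq_1) simp
    hence "b - 1 = - c" by (simp add: b_def c_def algebra_simps)
    moreover have "b ^ j - b ^ (j - 1) = b ^ (j - 1) * (b - 1)"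
      using assms by (cases j) (simp_all add: algebra_simps)
    ultimately have "b ^ j - b ^ (j - 1) = - (b ^ (j - 1) * c)" by simp
    moreover have "b ^ (j - 1) = (-1) ^ (j - 1) * (fps_X ^ (j - 1) * c ^ (j - 1))"
      unfolding b_def c_def by (subst power_minus) (simp add: power_mult_distrib)
    moreover have "inverse ((1 - fps_X :: 'a fps) ^ j) = c ^ (j - 1) * c"
      using assms unfolding c_def fps_inverse_power by (cases j) simp_all
    ultimately show ?thesis
      by (simp add: mult_ac flip: fps_const_power fps_const_neg)
  qed
  also have "\<dots> $ i = - ((-1) ^ (j - 1) * of_nat (i choose (j - 1)))"
  proof (cases "j - 1 \<le> i")
    case True
    have "inverse ((1 - fps_X :: 'a fps) ^ j) = Abs_fps (\<lambda>k. of_nat ((j + k - 1) choose k))"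
      using one_minus_const_fps_X_neg_power'[of j 1] assms by simp
    moreover have "j + (i - (j - 1)) - 1 = i" using True assms by simp
    ultimately show ?thesis
      using True binomial_symmetric[OF True] by (simp add: fps_X_power_mult_nth not_less)
  qed (simp add: fps_X_power_mult_nth)
  finally show ?thesis by simp
qed

section \<open>Entries as Jacobi polynomials, and the conclusion\<close>

lemma jacobi_p_eq_qpow:
  "(-1) ^ n * jacobi_p \<alpha> \<alpha> n = (qpow ratfun_X (of_rat \<alpha> + of_nat n) :: 'a::field_char_0 poly fract fps) $ n"
  unfolding jacobi_p_altdef qpow_nth
  by (intro arg_cong2[where f = "(*)"] sum.cong refl arg_cong2[where f = "(gchoose)"]) (simp add: algebra_simps)

text \<open>Parameter -i and degree i - j give the exponent c = -i + (i - j) = -j of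
  \<open>qpow\<close>. For \<open>nmat\<close> the parameter j gives c = i in the same way.\<close>

lemma lmat_eq_jacobi_p:
  "(lmat ratfun_X i j :: 'a::field_char_0 poly fract) =
     (if i < j then 0 else (-1) ^ (i - j) * jacobi_p (- of_nat i) (- of_nat i) (i - j))"
  by (simp add: lmat_def jacobi_p_eq_qpow of_rat_minus of_nat_diff flip: qpow_minus_of_nat)

lemma nmat_eq_jacobi_p:
  "(nmat ratfun_X i j :: 'a::field_char_0 poly fract) =
     (if i < j then 0 else (-1) ^ (i - j) * (of_nat j / of_nat i) * jacobi_p (of_nat j) (of_nat j) (i - j))"
  using jacobi_p_eq_qpow[where 'a = 'a, of "i - j" "of_nat j"]
  by (cases "i < j") (simp_all add: nmat_def of_nat_diff flip: qpow_of_nat)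

lemma to_fract_Mtilde:
  "to_fract (Mtilde i j) = ratfun_X ^ i * of_nat ((i + j - 2) choose (j - 1))
     - (-1) ^ (j - 1) * of_nat (i choose (j - 1))"
  by (simp add: Mtilde_def ratfun_X_def to_fract_power to_fract_of_nat)

theorem theorem4p1:
  fixes M :: "nat \<Rightarrow> nat \<Rightarrow> 'a::field_char_0 poly fract"
  defines "M \<equiv> (\<lambda>i j. to_fract (Mtilde i j))"
  shows "(\<exists>L U N. is_LU_decomposition M L U \<and> is_inf_mat_inverse L N) \<and>
    (\<forall>L U N. is_LU_decomposition M L U \<and> is_inf_mat_inverse L N \<longrightarrow>
      (\<forall>i\<ge>1. \<forall>j\<ge>1.
        L i j = (if i < j then 0
                 else (-1) ^ (i - j) * jacobi_p (- of_nat i) (- of_nat i) (i - j)) \<and>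
        N i j = (if i < j then 0
                 else (-1) ^ (i - j) * (of_nat j / of_nat i)
                      * jacobi_p (of_nat j) (of_nat j) (i - j))))"
proof -
  define x :: "'a poly fract" where "x = ratfun_X"
  have LU: "is_LU_decomposition M (lmat x) (umat x)"
    by (simp add: is_LU_decomposition_def lmat_lower_unitriangular umat_upper_triangular
        lmat_umat M_def to_fract_Mtilde x_def)
  have inv: "is_inf_mat_inverse (lmat x) (nmat x)"
    by (intro is_inf_mat_inverse_lower_unitriangularI lmat_lower_unitriangular
        nmat_lower_unitriangular nmat_lmat)
  have nz: "umat x j j \<noteq> 0" if "j \<ge> 1" for j
    using ratfun_X_neq_1 that by (simp add: umat_diag x_def)
  have "L i j = lmat x i j \<and> N i j = nmat x i j"
    if "is_LU_decomposition M L U" "is_inf_mat_inverse L N" "1 \<le> i" "1 \<le> j" for L U N i j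
  proof -
    \<comment> \<open>All entries of \<open>L\<close> are identified first, since uniqueness of the
      inverse compares two inverses of the same matrix.\<close>
    have "lmat x i j = L i j" if "1 \<le> i" "1 \<le> j" for i j
      using LU_decomposition_unique[OF LU \<open>is_LU_decomposition M L U\<close> nz that] .
    with inf_mat_inverse_unique[OF lmat_lower_unitriangular inv that(2)] that show ?thesis
      by simp
  qed
  thus ?thesis
    using LU inv unfolding x_def lmat_eq_jacobi_p nmat_eq_jacobi_p by blast
qed

end
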